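(* Let $\mathcal{P}$ be a vertex selection problem that has the exchange property. Then for every $d\in\mathbb{N}$, there is a level-aware isolation scheme for $\mathcal{P}$ on graphs of treedepth at most $d$ that uses $\mathcal{O}(d)$ random bits and assigns weights bounded by $\mathcal{O}(n^6)$, where $n$ is the number of vertices.
   Context: A vertex selection problem maps every graph $G$ to a family $\mathcal{P}(G)\subseteq 2^{V(G)}$. In a rooted forest $F$, $\mathsf{tail}_F(u)$ is the set of strict ancestors of $u$, the level $\mathrm{lvl}_F(u)=|\mathsf{tail}_F(u)|$, and the height of $F$ is the maximum level plus one. An elimination forest of $G$ is a rooted forest $F$ with $V(F)=V(G)$ such that for every edge $uv$, $u$ is an ancestor of $v$ or vice versa; treedepth is the minimum height of an elimination forest. For $A,B\subseteq V(G)$, a vertex $u$ is pivotal for $A$ and $B$ in $F$ if $u\in A\triangle B$ and $\mathsf{tail}_F(u)\cap A=\mathsf{tail}_F(u)\cap B$. For $\omega\colon V(G)\to\mathbb{N}$, $\omega(X)=\sum_{v\in X}\omega(v)$, a minimizer of $\omega$ on $\mathcal{P}(G)$ is a member of minimum weight, and $\omega$ isolates $\mathcal{P}(G)$ if there is exactly one minimizer. $\mathcal{P}$ has the exchange property if for every graph $G$, elimination forest $F$ of $G$ and $\omega\colon V(G)\to\mathbb{N}$: if there are two different minimizers of $\omega$ on $\mathcal{P}(G)$, then there are minimizers $A',B'$ of $\omega$ on $\mathcal{P}(G)$ with exactly one pivotal vertex in $F$. $\mathcal{P}$ admits a level-aware isolation scheme if for all $n,d$ there exist $\omega_1,\ldots,\omega_\ell\colon[n]\times\{0,\ldots,d-1\}\to\mathbb{N}$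 such that for every graph $G$ on vertex set $[n]$ and elimination forest $F$ of $G$ of height at most $d$, at least half of the $\omega_i$ isolate $\mathcal{P}(G)$, where $\omega_i$ assigns to vertex $u$ the weight $\omega_i(u,\mathrm{lvl}_F(u))$; it uses $\log\ell$ random bits and its maximum weight is the largest value of the $\omega_i$.
   Formalization: Isolation by at least half of the weight functions is required only for graphs G with P(G) nonempty; if P(G) is empty there is no minimizer, so the claim as literally stated fails (e.g. for P constantly empty, which has the exchange property vacuously). *)

theory Defs
  imports Complex_Main "Graph_Theory.Pair_Digraph"
begin

text \<open>
  Finite simple graphs are taken from the library as \<^const>\<open>pair_graph\<close>s: finite, symmetric,
  loopless sets of pairs.  Vertices are natural numbers throughout, so that the class of all
  graphs contains the graphs on vertex set \<open>{1..n}\<close>.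
\<close>

definition vertex_selection_problem :: "(nat pair_pre_digraph \<Rightarrow> nat set set) \<Rightarrow> bool" where
  "vertex_selection_problem P \<longleftrightarrow> (\<forall>G. pair_graph G \<longrightarrow> P G \<subseteq> Pow (pverts G))"


section \<open>Rooted forests\<close>

text \<open>A rooted forest is given by its vertex set and parent map; roots are mapped to \<^const>\<open>None\<close>.\<close>

record 'a rforest =
  fverts :: "'a set"
  parent :: "'a \<Rightarrow> 'a option"

definition parent_rel :: "'a rforest \<Rightarrow> ('a \<times> 'a) set" where
  "parent_rel F = {(v, p). parent F v = Some p}"

definition rooted_forest :: "'a rforest \<Rightarrow> bool" where
  "rooted_forest F \<longleftrightarrow>
     finite (fverts F) \<and> parent_rel F \<subseteq> fverts F \<times> fverts F \<and> acyclic (parent_rel F)"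

text \<open>The set of strict ancestors.\<close>

definition ftail :: "'a rforest \<Rightarrow> 'a \<Rightarrow> 'a set" where
  "ftail F u = {a. (u, a) \<in> (parent_rel F)\<^sup>+}"

definition lvl :: "'a rforest \<Rightarrow> 'a \<Rightarrow> nat" where
  "lvl F u = card (ftail F u)"

text \<open>The empty forest has height 0.\<close>

definition height :: "'a rforest \<Rightarrow> nat" where
  "height F = Max (insert 0 ((\<lambda>u. lvl F u + 1) ` fverts F))"

text \<open>A graph has treedepth at most \<open>d\<close> iff it has an elimination forest of height at most \<open>d\<close>.\<close>

definition elimination_forest :: "'a pair_pre_digraph \<Rightarrow> 'a rforest \<Rightarrow> bool" where
  "elimination_forest G F \<longleftrightarrow>
     rooted_forest F \<and> fverts F = pverts G \<and>
     (\<forall>(u, v) \<in> parcs G. u \<in> ftail F v \<or> v \<in> ftail F u)"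

definition pivotal :: "'a rforest \<Rightarrow> 'a set \<Rightarrow> 'a set \<Rightarrow> 'a \<Rightarrow> bool" where
  "pivotal F A B u \<longleftrightarrow> u \<in> (A - B) \<union> (B - A) \<and> ftail F u \<inter> A = ftail F u \<inter> B"


section \<open>Minimizers, isolation and the exchange property\<close>

definition minimizer :: "('a \<Rightarrow> nat) \<Rightarrow> 'a set set \<Rightarrow> 'a set \<Rightarrow> bool" where
  "minimizer \<omega> \<F> A \<longleftrightarrow> is_arg_min (\<lambda>X. \<Sum>v\<in>X. \<omega> v) (\<lambda>X. X \<in> \<F>) A"

definition isolates :: "('a \<Rightarrow> nat) \<Rightarrow> 'a set set \<Rightarrow> bool" where
  "isolates \<omega> \<F> \<longleftrightarrow> (\<exists>!A. minimizer \<omega> \<F> A)"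

definition exchange_property :: "(nat pair_pre_digraph \<Rightarrow> nat set set) \<Rightarrow> bool" where
  "exchange_property P \<longleftrightarrow>
     (\<forall>G F \<omega>. pair_graph G \<and> elimination_forest G F \<and>
        (\<exists>A B. A \<noteq> B \<and> minimizer \<omega> (P G) A \<and> minimizer \<omega> (P G) B) \<longrightarrow>
        (\<exists>A' B'. minimizer \<omega> (P G) A' \<and> minimizer \<omega> (P G) B' \<and> (\<exists>!u. pivotal F A' B' u)))"


section \<open>Level-aware isolation schemes\<close>

text \<open>
  A scheme is the nonempty list of its weight functions \<open>\<omega>\<^sub>1, \<dots>, \<omega>\<^sub>\<ell>\<close>; only their values on
  \<open>{1..n} \<times> {..<d}\<close> matter.  Graphs with an empty solution family are excluded: they have no
  minimizer, so no weight function isolates them.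
\<close>

definition level_aware_isolation_scheme ::
  "(nat pair_pre_digraph \<Rightarrow> nat set set) \<Rightarrow> nat \<Rightarrow> nat \<Rightarrow> (nat \<Rightarrow> nat \<Rightarrow> nat) list \<Rightarrow> bool" where
  "level_aware_isolation_scheme P n d \<omega>s \<longleftrightarrow>
     \<omega>s \<noteq> [] \<and>
     (\<forall>G F. pair_graph G \<and> pverts G = {1..n} \<and> elimination_forest G F \<and> height F \<le> d \<and>
        P G \<noteq> {} \<longrightarrow>
        real (card {i. i < length \<omega>s \<and> isolates (\<lambda>u. (\<omega>s ! i) u (lvl F u)) (P G)})
          \<ge> real (length \<omega>s) / 2)"

definition random_bits :: "(nat \<Rightarrow> nat \<Rightarrow> nat) list \<Rightarrow> real" where
  "random_bits \<omega>s = log 2 (real (length \<omega>s))"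

definition max_weight :: "nat \<Rightarrow> nat \<Rightarrow> (nat \<Rightarrow> nat \<Rightarrow> nat) list \<Rightarrow> nat" where
  "max_weight n d \<omega>s = Max (insert 0 {\<omega> u j | \<omega> u j. \<omega> \<in> set \<omega>s \<and> u \<in> {1..n} \<and> j < d})"

end

theory Submission
  imports Defs "HOL-Library.FuncSet"
begin

text \<open>
  If \<open>u\<close> is the only pivotal vertex of \<open>A\<close> and \<open>B\<close>, then every other element of the symmetric
  difference is a strict descendant of \<open>u\<close>.  Hence the weights \<open>2 ^ lvl u\<close> always isolate: the
  difference of the weights of \<open>A\<close> and \<open>B\<close> is an odd multiple of \<open>2 ^ lvl u\<close>.  To keep the weights
  polynomial, the levels are cut into blocks of \<open>b \<approx> log n\<close> consecutive levels, and the weight of a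
  vertex on level \<open>j\<close> is \<open>r\<^sub>k * 2 ^ (j mod b)\<close> for \<open>k = j div b\<close>.  The factor \<open>r\<^sub>k\<close> of each of the
  \<open>d div b\<close> complete blocks is drawn from \<open>2 ^ (3 * b)\<close> values, which costs \<open>3 * b\<close> bits per block;
  the factor of the incomplete last block is \<open>1\<close>.  With the other factors fixed, the weight of a
  solution \<open>X\<close> is \<open>c X + r\<^sub>k * a X\<close> with \<open>a X\<close> polynomially bounded.  So \<open>r\<^sub>k\<close> creates minimizers with
  different values of \<open>a\<close> only at the breakpoints of a lower envelope of polynomially many lines.
\<close>

section \<open>Levels in rooted forests and the unique pivotal vertex\<close>

lemma ftail_subset:
  assumes "rooted_forest F"
  shows "ftail F v \<subseteq> fverts F - {v}"
proof
  fix a assume "a \<in> ftail F v"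
  then have va: "(v, a) \<in> (parent_rel F)\<^sup>+" by (simp add: ftail_def)
  have sub: "parent_rel F \<subseteq> fverts F \<times> fverts F" and ac: "acyclic (parent_rel F)"
    using assms by (auto simp: rooted_forest_def)
  have "a \<in> fverts F" using trancl_subset_Sigma[OF sub] va by auto
  moreover have "a \<noteq> v" using ac va by (auto simp: acyclic_def)
  ultimately show "a \<in> fverts F - {v}" by simp
qed

lemma lvl_less_card:
  assumes "rooted_forest F" "v \<in> fverts F"
  shows "lvl F v < card (fverts F)"
proof -
  have fin: "finite (fverts F)" using assms by (simp add: rooted_forest_def)
  have "ftail F v \<subset> fverts F" using ftail_subset[OF assms(1)] assms(2) by blast
  then show ?thesis unfolding lvl_def by (rule psubset_card_mono[OF fin])
qed

lemma lvl_less_height: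
  assumes "rooted_forest F" "v \<in> fverts F"
  shows "lvl F v < height F"
proof -
  have fin: "finite (fverts F)" using assms by (simp add: rooted_forest_def)
  have "lvl F v + 1 \<le> height F"
    unfolding height_def using fin assms(2) by (intro Max_ge) auto
  then show ?thesis by simp
qed

lemma ftail_trans:
  "x \<in> ftail F w \<Longrightarrow> w \<in> ftail F v \<Longrightarrow> x \<in> ftail F v"
  by (auto simp: ftail_def)

lemma lvl_ftail_less:
  assumes "rooted_forest F" "w \<in> ftail F v"
  shows "lvl F w < lvl F v"
proof -
  have fin: "finite (ftail F v)"
    using ftail_subset[OF assms(1)] assms(1) finite_subset by (fastforce simp: rooted_forest_def)
  have "ftail F w \<subset> ftail F v"
    using ftail_trans[OF _ assms(2)] assms(2) ftail_subset[OF assms(1), of w] by blast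
  then show ?thesis unfolding lvl_def by (rule psubset_card_mono[OF fin])
qed

text \<open>Among \<open>v\<close> and its ancestors, take a vertex of least level on which
  \<open>A\<close> and \<open>B\<close> differ. No ancestor of it separates \<open>A\<close> from
  \<open>B\<close>, so it is pivotal, hence equal to \<open>u\<close>; thus \<open>u\<close> is a
  strict ancestor of \<open>v\<close>.\<close>

lemma unique_pivotal_lvl_less:
  assumes F: "rooted_forest F" and ex1: "\<exists>!u. pivotal F A B u" and u: "pivotal F A B u"
    and v: "v \<in> (A - B) \<union> (B - A)" "v \<noteq> u"
  shows "lvl F u < lvl F v"
proof -
  let ?Q = "\<lambda>w. w \<in> (A - B) \<union> (B - A) \<and> (w = v \<or> w \<in> ftail F v)"
  obtain w where w: "?Q w" and min: "\<And>x. ?Q x \<Longrightarrow> lvl F w \<le> lvl F x"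
    using ex_has_least_nat[of ?Q v "lvl F"] v(1) by auto
  have "x \<in> A \<longleftrightarrow> x \<in> B" if "x \<in> ftail F w" for x
  proof (rule ccontr)
    assume "\<not> (x \<in> A \<longleftrightarrow> x \<in> B)"
    then have "?Q x" using that w ftail_trans by fastforce
    then show False using min[of x] lvl_ftail_less[OF F that] by simp
  qed
  then have "pivotal F A B w" using w by (auto simp: pivotal_def)
  then have "w = u" using ex1 u by blast
  then show ?thesis using w v(2) lvl_ftail_less[OF F] by auto
qed

section \<open>Divisibility and counting tools\<close>

text \<open>After cancelling the common part, the side containing \<open>u\<close> is congruent to
  \<open>2 ^ e\<close> modulo \<open>2 ^ Suc e\<close>, while the other side is congruent to
  0.\<close>

lemma sum_neq_of_unique_least_valuation:
  fixes g :: "'a \<Rightarrow> nat"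
  assumes fin: "finite A" "finite B" and u: "u \<in> (A - B) \<union> (B - A)" and gu: "g u = 2 ^ e"
    and dvd: "\<And>v. v \<in> (A - B) \<union> (B - A) \<Longrightarrow> v \<noteq> u \<Longrightarrow> 2 ^ Suc e dvd g v"
  shows "sum g A \<noteq> sum g B"
proof -
  have *: "sum g C \<noteq> sum g D"
    if fin: "finite C" "finite D" and u: "u \<in> C - D"
      and dvd: "\<And>v. v \<in> (C - D) \<union> (D - C) \<Longrightarrow> v \<noteq> u \<Longrightarrow> 2 ^ Suc e dvd g v" for C D
  proof
    assume eq: "sum g C = sum g D"
    have "sum g C = sum g (C \<inter> D) + sum g (C - D)" "sum g D = sum g (C \<inter> D) + sum g (D - C)"
      using fin by (metis sum.Int_Diff, metis Int_commute sum.Int_Diff)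
    moreover have "sum g (C - D) = g u + sum g (C - D - {u})"
      using fin u by (intro sum.remove) auto
    ultimately have "sum g (D - C) = 2 ^ e + sum g (C - D - {u})" using eq gu by simp
    moreover have "2 ^ Suc e dvd sum g (D - C)" using u by (intro dvd_sum dvd) auto
    moreover have "2 ^ Suc e dvd sum g (C - D - {u})" by (intro dvd_sum dvd) auto
    ultimately have "(2::nat) ^ Suc e dvd 2 ^ e" using dvd_add_left_iff by metis
    then show False by (simp add: power_dvd_imp_le)
  qed
  from u show ?thesis
  proof
    assume "u \<in> A - B" then show ?thesis using *[of A B] fin dvd by blast
  next
    assume "u \<in> B - A" then show ?thesis using *[of B A] fin dvd by (metis Un_commute)
  qed
qed

text \<open>The slopes of the minimizing lines strictly decrease from one breakpoint to the next.\<close>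

lemma card_breakpoints_le:
  fixes a c :: "'a \<Rightarrow> nat"
  assumes bound: "\<And>X. X \<in> \<F> \<Longrightarrow> a X \<le> M"
  shows "card {x \<in> {..<R}. \<exists>A B. is_arg_min (\<lambda>X. c X + x * a X) (\<lambda>X. X \<in> \<F>) A \<and>
    is_arg_min (\<lambda>X. c X + x * a X) (\<lambda>X. X \<in> \<F>) B \<and> a A \<noteq> a B} \<le> M"
    (is "card ?S \<le> M")
proof -
  define m where "m x X \<longleftrightarrow> X \<in> \<F> \<and> (\<forall>Y\<in>\<F>. c X + x * a X \<le> c Y + x * a Y)" for x X
  have m: "is_arg_min (\<lambda>X. c X + x * a X) (\<lambda>X. X \<in> \<F>) X \<longleftrightarrow> m x X" for x X
    by (simp add: is_arg_min_linorder m_def Ball_def)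
  have "\<exists>p. m x (fst p) \<and> m x (snd p) \<and> a (snd p) < a (fst p)" if "x \<in> ?S" for x
    using that unfolding m by (auto simp: neq_iff)
  then have "\<exists>p. \<forall>x\<in>?S. m x (fst (p x)) \<and> m x (snd (p x)) \<and> a (snd (p x)) < a (fst (p x))"
    by (intro bchoice ballI)
  then obtain p where
    p: "\<And>x. x \<in> ?S \<Longrightarrow> m x (fst (p x)) \<and> m x (snd (p x)) \<and> a (snd (p x)) < a (fst (p x))"
    by blast
  define A B where "A x = fst (p x)" and "B x = snd (p x)" for x
  have AB: "m x (A x) \<and> m x (B x) \<and> a (B x) < a (A x)" if "x \<in> ?S" for x
    using p[OF that] by (simp only: A_def B_def)
  have dec: "a (A y) < a (A x)" if xy: "x \<in> ?S" "y \<in> ?S" "x < y" for x y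
  proof -
    \<comment> \<open>\<open>B x\<close> is optimal at \<open>x\<close> and \<open>A y\<close> at
      \<open>y\<close>. Adding the two inequalities cancels \<open>c\<close> and leaves a comparison
      of slopes scaled by \<open>y - x\<close>.\<close>
    have "c (B x) + x * a (B x) \<le> c (A y) + x * a (A y)"
      "c (A y) + y * a (A y) \<le> c (B x) + y * a (B x)"
      using AB[OF xy(1)] AB[OF xy(2)] by (auto simp: m_def)
    moreover obtain z where z: "y = x + z" "z > 0" using xy(3) less_imp_add_positive by blast
    ultimately have "z * a (A y) \<le> z * a (B x)" unfolding z(1) add_mult_distrib by linarith
    then have "a (A y) \<le> a (B x)" using z by simp
    then show ?thesis using AB[OF xy(1)] by linarith
  qed
  have "inj_on (\<lambda>x. a (A x)) ?S"
  proof (rule inj_onI)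
    fix x y assume "x \<in> ?S" "y \<in> ?S" and eq: "a (A x) = a (A y)"
    then have "\<not> x < y" "\<not> y < x" using dec[of x y] dec[of y x] by linarith+
    then show "x = y" by simp
  qed
  \<comment> \<open>The larger slope at a breakpoint exceeds another natural number, so 0 is
    excluded and the bound is \<open>M\<close> rather than \<open>M + 1\<close>.\<close>
  moreover have "(\<lambda>x. a (A x)) ` ?S \<subseteq> {1..M}"
  proof (rule image_subsetI)
    fix x assume "x \<in> ?S"
    from AB[OF this] show "a (A x) \<in> {1..M}" using bound by (fastforce simp: m_def)
  qed
  ultimately have "card ?S \<le> card {1..M}" by (intro card_inj_on_le) auto
  then show ?thesis by simp
qed

text \<open>
  Double counting of the pairs \<open>(f, x)\<close> with \<open>f(k := x) \<in> S\<close>: exchanging \<open>f k\<close> and \<open>x\<close> maps these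
  pairs bijectively onto \<open>S \<times> {..<R}\<close>.
\<close>

lemma card_PiE_le_of_card_fibres_le:
  fixes S :: "(nat \<Rightarrow> nat) set"
  assumes k: "k < K" and S: "S \<subseteq> PiE {..<K} (\<lambda>_. {..<R})"
    and fib: "\<And>f. f \<in> PiE {..<K} (\<lambda>_. {..<R}) \<Longrightarrow> card {x \<in> {..<R}. f(k := x) \<in> S} \<le> M"
  shows "card S * R \<le> M * R ^ K"
proof -
  let ?D = "PiE {..<K} (\<lambda>_. {..<R})"
  let ?T = "SIGMA f:?D. {x \<in> {..<R}. f(k := x) \<in> S}"
  have fin: "finite ?D" by (intro finite_PiE) auto
  have upd: "f(k := x) \<in> ?D" if "f \<in> ?D" "x < R" for f x
    using that k by (auto simp: PiE_iff extensional_def)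
  have fk: "f k < R" if "f \<in> ?D" for f using that k by (auto simp: PiE_iff)
  have "bij_betw (\<lambda>(f, x). (f(k := x), f k)) ?T (S \<times> {..<R})"
  proof (rule bij_betwI[where g = "\<lambda>(f, x). (f(k := x), f k)"])
    show "(\<lambda>(f, x). (f(k := x), f k)) \<in> ?T \<rightarrow> S \<times> {..<R}" using fk by auto
    show "(\<lambda>(f, x). (f(k := x), f k)) \<in> S \<times> {..<R} \<rightarrow> ?T"
    proof
      fix p assume "p \<in> S \<times> {..<R}"
      then obtain f x where p: "p = (f, x)" "f \<in> S" "x < R" by auto
      then have "f \<in> ?D" using S by blast
      with p show "(\<lambda>(f, x). (f(k := x), f k)) p \<in> ?T" using upd fk by simp
    qed
  qed (clarsimp simp: PiE_iff)+
  then have "card S * R = card ?T" by (simp add: bij_betw_same_card card_cartesian_product)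
  also have "\<dots> = (\<Sum>f\<in>?D. card {x \<in> {..<R}. f(k := x) \<in> S})"
    using fin by (intro card_SigmaI) auto
  also have "\<dots> \<le> (\<Sum>f\<in>?D. M)" by (intro sum_mono fib)
  also have "\<dots> = M * R ^ K" by (simp add: card_PiE)
  finally show ?thesis .
qed

section \<open>Block weights and the proportion of non-isolating factors\<close>

definition block_weight :: "nat \<Rightarrow> nat \<Rightarrow> (nat \<Rightarrow> nat) \<Rightarrow> nat \<Rightarrow> nat" where
  "block_weight b K f j = (if j div b < K then f (j div b) else 1) * 2 ^ (j mod b)"

text \<open>For \<open>k < K\<close> this is the coefficient of \<open>f k\<close> in
  \<open>block_weight b K f j\<close>; summed over a solution it gives the slope of that solution's
  line.\<close>

definition block_part :: "nat \<Rightarrow> nat \<Rightarrow> nat \<Rightarrow> nat" where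
  "block_part b k j = (if j div b = k then 2 ^ (j mod b) else 0)"

lemma block_weight_fun_upd:
  assumes "k < K"
  shows "block_weight b K (f(k := x)) j =
    (if j div b = k then 0 else block_weight b K f j) + x * block_part b k j"
  using assms by (auto simp: block_weight_def block_part_def)

text \<open>The exchange property gives minimizers with a single pivotal vertex \<open>u\<close>,
  and \<open>k\<close> is the block of its level. Inside that block \<open>u\<close> has the least
  power of two among the vertices where \<open>A\<close> and \<open>B\<close> differ, so the block
  sums are unequal.\<close>

lemma minimizers_differ_in_block:
  assumes P: "vertex_selection_problem P" "exchange_property P"
    and G: "pair_graph G" "elimination_forest G F" and h: "height F \<le> d" and ne: "P G \<noteq> {}"
    and b: "b \<ge> 1" and K: "K = d div b"
    and niso: "\<not> isolates (\<lambda>u. block_weight b K f (lvl F u)) (P G)"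
  obtains k A B where "k < K" "k < card (pverts G)"
    "minimizer (\<lambda>u. block_weight b K f (lvl F u)) (P G) A"
    "minimizer (\<lambda>u. block_weight b K f (lvl F u)) (P G) B"
    "(\<Sum>v\<in>A. block_part b k (lvl F v)) \<noteq> (\<Sum>v\<in>B. block_part b k (lvl F v))"
proof -
  let ?w = "\<lambda>u. block_weight b K f (lvl F u)"
  have F: "rooted_forest F" and FG: "fverts F = pverts G"
    using G(2) by (auto simp: elimination_forest_def)
  have PG: "P G \<subseteq> Pow (pverts G)" using P(1) G(1) by (auto simp: vertex_selection_problem_def)
  have finG: "finite (pverts G)" using F FG by (simp add: rooted_forest_def)
  obtain X where "X \<in> P G" using ne by blast
  from ex_has_least_nat[of "\<lambda>X. X \<in> P G", OF this, of "sum ?w"]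
  have "\<exists>A. minimizer ?w (P G) A" unfolding minimizer_def is_arg_min_linorder by blast
  then have "\<exists>A B. A \<noteq> B \<and> minimizer ?w (P G) A \<and> minimizer ?w (P G) B"
    using niso unfolding isolates_def by metis
  then have "\<exists>A B. minimizer ?w (P G) A \<and> minimizer ?w (P G) B \<and> (\<exists>!u. pivotal F A B u)"
    by (intro P(2)[unfolded exchange_property_def, rule_format]) (simp add: G)
  then obtain A B where A: "minimizer ?w (P G) A" and B: "minimizer ?w (P G) B"
    and ex1: "\<exists>!u. pivotal F A B u"
    by (elim exE conjE)
  obtain u where u: "pivotal F A B u" using ex1 by (elim ex1E)
  have AG: "A \<subseteq> pverts G" and BG: "B \<subseteq> pverts G"
    using A B PG by (auto simp: minimizer_def is_arg_min_def)
  have finAB: "finite A" "finite B" using AG BG finG finite_subset by auto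
  have uD: "u \<in> (A - B) \<union> (B - A)" using u by (simp add: pivotal_def)
  have less: "lvl F u < lvl F v" if "v \<in> (A - B) \<union> (B - A)" "v \<noteq> u" for v
    by (rule unique_pivotal_lvl_less[OF F ex1 u that])
  define k where "k = lvl F u div b"
  have mod_less: "(2::nat) ^ Suc (lvl F u mod b) dvd 2 ^ (lvl F v mod b)"
    if "lvl F u < lvl F v" "lvl F v div b = k" for v
  proof -
    have "lvl F u mod b < lvl F v mod b"
      using that unfolding k_def
      by (metis add_less_cancel_left mult_div_mod_eq)
    then show ?thesis by (intro le_imp_power_dvd) simp
  qed
  show thesis
  proof (cases "k < K")
    case True
    \<comment> \<open>This bounds the number of relevant blocks by the number of vertices, however
      large \<open>d\<close> is.\<close>
    have "lvl F u < card (pverts G)" using lvl_less_card[OF F, of u] uD AG BG FG by auto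
    then have "k < card (pverts G)" unfolding k_def using div_le_dividend le_less_trans by blast
    moreover have "(\<Sum>v\<in>A. block_part b k (lvl F v)) \<noteq> (\<Sum>v\<in>B. block_part b k (lvl F v))"
      by (rule sum_neq_of_unique_least_valuation[OF finAB uD, where e = "lvl F u mod b"])
        (use less mod_less in \<open>auto simp: block_part_def k_def\<close>)
    ultimately show thesis using that True A B by blast
  next
    case False
    \<comment> \<open>Levels below \<open>d\<close> lie in blocks up to \<open>K\<close>, so here
      all vertices where \<open>A\<close> and \<open>B\<close> differ lie in block \<open>K\<close>,
      whose factor is 1. Then the full weights of \<open>A\<close> and \<open>B\<close> already
      differ, which is impossible for two minimizers.\<close>
    have dvd: "2 ^ Suc (lvl F u mod b) dvd ?w v"
      if v: "v \<in> (A - B) \<union> (B - A)" "v \<noteq> u" for v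
    proof -
      have "lvl F v < d" using lvl_less_height[OF F, of v] v AG BG FG h by auto
      then have "lvl F v div b \<le> K" unfolding K by (intro div_le_mono) simp
      moreover have "k \<le> lvl F v div b"
        unfolding k_def using less[OF v] by (intro div_le_mono) simp
      ultimately have "lvl F v div b = k" "\<not> lvl F v div b < K" using False by auto
      then show ?thesis using mod_less[OF less[OF v]] by (simp add: block_weight_def)
    qed
    have "sum ?w A \<noteq> sum ?w B"
      by (rule sum_neq_of_unique_least_valuation[OF finAB uD _ dvd])
        (use False in \<open>auto simp: block_weight_def k_def\<close>)
    moreover have "sum ?w A = sum ?w B"
      using A B by (auto simp: minimizer_def is_arg_min_linorder intro: order_antisym)
    ultimately show thesis by simp
  qed
qed

text \<open>Union bound: each block spoils at most a fraction \<open>M / R\<close> of the functions,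
  and at most \<open>n\<close> blocks matter. With \<open>M = n * 2 ^ (b - 1)\<close> and
  \<open>n < 2 ^ b\<close>, the choice \<open>R = 2 ^ (3 * b)\<close> makes \<open>n * M / R\<close>
  at most 1/2.\<close>

lemma card_nonisolating_le:
  assumes P: "vertex_selection_problem P" "exchange_property P"
    and G: "pair_graph G" "pverts G = {1..n}" "elimination_forest G F"
    and h: "height F \<le> d" and ne: "P G \<noteq> {}"
    and b: "b \<ge> 1" "n < 2 ^ b" and K: "K = d div b" and R: "R = 2 ^ (3 * b)"
  shows "2 * card {f \<in> PiE {..<K} (\<lambda>_. {..<R}).
    \<not> isolates (\<lambda>u. block_weight b K f (lvl F u)) (P G)} \<le> R ^ K"
    (is "2 * card ?N \<le> _")
proof -
  let ?D = "PiE {..<K} (\<lambda>_. {..<R})"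
  let ?w = "\<lambda>f u. block_weight b K f (lvl F u)"
  define a where "a k X = (\<Sum>v\<in>X. block_part b k (lvl F v))" for k X
  define S where "S k = {f \<in> ?D. \<exists>A B. minimizer (?w f) (P G) A \<and> minimizer (?w f) (P G) B \<and>
    a k A \<noteq> a k B}" for k
  define M where "M = n * 2 ^ (b - 1)"
  have finD: "finite ?D" by (intro finite_PiE) auto
  have PG: "P G \<subseteq> Pow {1..n}" using P(1) G(1,2) by (auto simp: vertex_selection_problem_def)
  have part_le: "block_part b k j \<le> 2 ^ (b - 1)" for k j
  proof -
    have "j mod b \<le> b - 1" using b(1) mod_less_divisor[of b j] by linarith
    then show ?thesis by (simp add: block_part_def)
  qed
  have aM: "a k X \<le> M" if "X \<in> P G" for k X
  proof -
    have sub: "X \<subseteq> {1..n}" using that PG by blast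
    then have "card X \<le> n" using card_mono[of "{1..n}" X] by simp
    moreover have "a k X \<le> card X * 2 ^ (b - 1)"
      unfolding a_def using sum_bounded_above[of X "\<lambda>v. block_part b k (lvl F v)" "2 ^ (b - 1)"]
        part_le by simp
    ultimately show ?thesis unfolding M_def by (meson mult_le_mono1 order_trans)
  qed
  have cardS: "card (S k) * R \<le> M * R ^ K" if k: "k < K" for k
  proof (rule card_PiE_le_of_card_fibres_le[OF k])
    fix f assume "f \<in> ?D"
    \<comment> \<open>The intercept ignores block \<open>k\<close>, so for fixed \<open>f\<close>
      the weights under \<open>f(k := x)\<close> are lines in \<open>x\<close>, and the bad
      \<open>x\<close> are breakpoints of their lower envelope.\<close>
    define c where "c X = (\<Sum>v\<in>X. if lvl F v div b = k then 0 else ?w f v)" for X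
    have "sum (?w (f(k := x))) = (\<lambda>X. c X + x * a k X)" for x
      by (simp add: fun_eq_iff block_weight_fun_upd[OF k] c_def a_def sum.distrib sum_distrib_left)
    then have "{x \<in> {..<R}. f(k := x) \<in> S k} \<subseteq> {x \<in> {..<R}.
        \<exists>A B. is_arg_min (\<lambda>X. c X + x * a k X) (\<lambda>X. X \<in> P G) A \<and>
          is_arg_min (\<lambda>X. c X + x * a k X) (\<lambda>X. X \<in> P G) B \<and> a k A \<noteq> a k B}"
      (is "_ \<subseteq> ?T") unfolding S_def minimizer_def by auto
    then have "card {x \<in> {..<R}. f(k := x) \<in> S k} \<le> card ?T" by (intro card_mono) auto
    also have "\<dots> \<le> M" by (rule card_breakpoints_le) (rule aM)
    finally show "card {x \<in> {..<R}. f(k := x) \<in> S k} \<le> M" .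
  qed (auto simp: S_def)
  have "?N \<subseteq> (\<Union>k \<in> {..<min K n}. S k)"
  proof
    fix f assume "f \<in> ?N"
    then have f: "f \<in> ?D" and niso: "\<not> isolates (?w f) (P G)" by auto
    obtain k A B where k: "k < K" "k < card (pverts G)" and
      AB: "minimizer (?w f) (P G) A" "minimizer (?w f) (P G) B" "a k A \<noteq> a k B"
      by (rule minimizers_differ_in_block[OF P G(1,3) h ne b(1) K niso, folded a_def])
    have "f \<in> S k" using f AB unfolding S_def by blast
    moreover have "k < min K n" using k G(2) by simp
    ultimately show "f \<in> (\<Union>k \<in> {..<min K n}. S k)" by blast
  qed
  then have "card ?N \<le> card (\<Union>k \<in> {..<min K n}. S k)"
    using finD by (intro card_mono finite_UN_I) (auto simp: S_def)
  also have "\<dots> \<le> (\<Sum>k<min K n. card (S k))" by (rule card_UN_le) simp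
  finally have "card ?N * R \<le> (\<Sum>k<min K n. card (S k)) * R" by simp
  also have "\<dots> = (\<Sum>k<min K n. card (S k) * R)" by (rule sum_distrib_right)
  also have "\<dots> \<le> (\<Sum>k<min K n. M * R ^ K)" by (intro sum_mono cardS) simp
  also have "\<dots> \<le> n * (M * R ^ K)" by simp
  finally have "2 * card ?N * R \<le> n * n * (2 * 2 ^ (b - 1)) * R ^ K"
    by (simp add: M_def algebra_simps)
  also have "2 * 2 ^ (b - 1) = (2::nat) ^ b" using b(1) by (simp flip: power_Suc)
  also have "n * n * 2 ^ b * R ^ K \<le> 2 ^ b * 2 ^ b * 2 ^ b * R ^ K"
    using b(2) by (intro mult_le_mono) auto
  also have "\<dots> = R ^ K * R" by (simp add: R power3_eq_cube power_mult mult.commute[of 3])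
  finally show ?thesis by (simp add: R)
qed

section \<open>Choice of the block length and assembly of the scheme\<close>

text \<open>\<open>b\<close> is the binary length of \<open>n\<close>, with 0 given length 1. The
  lower bound on \<open>2 ^ b\<close> serves the union bound, the upper bound the size of the
  weights.\<close>

lemma ex_binary_length: "\<exists>b \<ge> 1. n < 2 ^ b \<and> (n = 0 \<or> (2::nat) ^ b \<le> 2 * n)"
proof (cases "n = 0")
  case True
  then show ?thesis by (intro exI[of _ 1]) simp
next
  case False
  then obtain m where "2 ^ m \<le> n" "n < 2 ^ (m + 1)"
    using ex_power_ivl1[of 2 n] by auto
  then show ?thesis by (intro exI[of _ "m + 1"]) simp
qed

theorem theorem8p1:
  shows "\<exists>c\<^sub>1 c\<^sub>2 :: real. c\<^sub>1 > 0 \<and> c\<^sub>2 > 0 \<and>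
    (\<forall>P. vertex_selection_problem P \<and> exchange_property P \<longrightarrow>
      (\<forall>d n :: nat. \<exists>\<omega>s.
        level_aware_isolation_scheme P n d \<omega>s \<and>
        random_bits \<omega>s \<le> c\<^sub>1 * real d \<and>
        real (max_weight n d \<omega>s) \<le> c\<^sub>2 * real n ^ 6))"
proof -
  have main: "\<exists>\<omega>s. level_aware_isolation_scheme P n d \<omega>s \<and>
      random_bits \<omega>s \<le> 3 * real d \<and> real (max_weight n d \<omega>s) \<le> 16 * real n ^ 6"
    if P: "vertex_selection_problem P" "exchange_property P" for P d n
  proof -
    obtain b where b: "b \<ge> 1" "n < 2 ^ b" "n = 0 \<or> (2::nat) ^ b \<le> 2 * n"
      using ex_binary_length by blast
    define K where "K = d div b"
    define R :: nat where "R = 2 ^ (3 * b)"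
    let ?D = "PiE {..<K} (\<lambda>_. {..<R})"
    have "finite ?D" by (intro finite_PiE) auto
    then obtain fs where fs: "set fs = ?D" "distinct fs" using finite_distinct_list by metis
    define \<omega>s where "\<omega>s = map (\<lambda>f (u::nat) j. block_weight b K f j) fs"
    have "length fs = card ?D" using distinct_card[OF fs(2)] by (simp only: fs(1))
    then have len: "length \<omega>s = R ^ K" by (simp add: \<omega>s_def card_PiE)
    have "level_aware_isolation_scheme P n d \<omega>s"
      unfolding level_aware_isolation_scheme_def
    proof (intro conjI allI impI)
      show "\<omega>s \<noteq> []" using len by (auto simp: R_def)
      fix G F
      assume G: "pair_graph G \<and> pverts G = {1..n} \<and> elimination_forest G F \<and> height F \<le> d \<and>
        P G \<noteq> {}"
      let ?iso = "\<lambda>f. isolates (\<lambda>u. block_weight b K f (lvl F u)) (P G)"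
      have "card {i. i < length \<omega>s \<and> isolates (\<lambda>u. (\<omega>s ! i) u (lvl F u)) (P G)} =
          length (filter ?iso fs)"
        unfolding length_filter_conv_card by (simp add: \<omega>s_def cong: conj_cong)
      moreover have "length (filter ?iso fs) + length (filter (\<lambda>f. \<not> ?iso f) fs) = R ^ K"
        unfolding sum_length_filter_compl using len by (simp add: \<omega>s_def)
      \<comment> \<open>\<open>fs\<close> lists \<open>?D\<close> without repetition, so counting
        list positions is counting functions.\<close>
      moreover have "length (filter (\<lambda>f. \<not> ?iso f) fs) = card {f \<in> ?D. \<not> ?iso f}"
        using distinct_card[OF distinct_filter[OF fs(2)], of "\<lambda>f. \<not> ?iso f"]
        unfolding set_filter fs(1) by (rule sym)
      moreover have "2 * card {f \<in> ?D. \<not> ?iso f} \<le> R ^ K"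
        using G by (intro card_nonisolating_le[OF P _ _ _ _ _ b(1,2) K_def R_def]) simp_all
      ultimately show "real (card {i. i < length \<omega>s \<and> isolates (\<lambda>u. (\<omega>s ! i) u (lvl F u)) (P G)})
          \<ge> real (length \<omega>s) / 2"
        unfolding len by linarith
    qed
    moreover have "random_bits \<omega>s \<le> 3 * real d"
    proof -
      \<comment> \<open>There are \<open>d div b\<close> blocks at \<open>3 * b\<close> bits each,
        so \<open>b\<close> cancels and the bound does not depend on \<open>n\<close>.\<close>
      have "R ^ K = 2 ^ (3 * b * K)" by (simp add: R_def power_mult)
      then have "random_bits \<omega>s = real (3 * b * K)"
        unfolding random_bits_def len by (simp add: log_nat_power)
      also have "3 * b * K \<le> 3 * d" by (simp add: K_def)
      finally show ?thesis by simp
    qed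
    moreover have "real (max_weight n d \<omega>s) \<le> 16 * real n ^ 6"
    proof -
      let ?V = "{\<omega> u j | \<omega> u j. \<omega> \<in> set \<omega>s \<and> u \<in> {1..n} \<and> j < d}"
      have V: "x \<le> 16 * n ^ 6" if "x \<in> ?V" for x
      proof -
        \<comment> \<open>For \<open>n = 0\<close> the set \<open>?V\<close> is empty, so any weight
          in it comes with \<open>n \<ge> 1\<close>, as the upper bound on \<open>2 ^ b\<close>
          requires.\<close>
        from that obtain f j where f: "f \<in> ?D" and x: "x = block_weight b K f j" and n: "n \<ge> 1"
          using fs by (auto simp: \<omega>s_def)
        have N: "2 ^ b \<le> 2 * n" using b n by simp
        have "(if j div b < K then f (j div b) else 1) \<le> R"
          using f by (auto simp: PiE_iff R_def intro: less_imp_le)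
        moreover have "(2::nat) ^ (j mod b) \<le> 2 ^ b" using b(1) by (simp add: less_imp_le)
        ultimately have "x \<le> R * 2 ^ b" unfolding x block_weight_def by (rule mult_le_mono)
        \<comment> \<open>Three factors \<open>2 ^ b\<close> come from \<open>R\<close> and one from
          the power within a block; \<open>2 ^ b \<le> 2 * n\<close> then yields the constant
          16.\<close>
        also have "\<dots> = (2 ^ b) ^ 4" by (simp add: R_def flip: power_mult power_add)
        also have "\<dots> \<le> (2 * n) ^ 4" by (rule power_mono[OF N]) simp
        also have "\<dots> = 16 * n ^ 4" by (simp add: power_mult_distrib)
        also have "\<dots> \<le> 16 * n ^ 6" using n by (simp add: power_increasing)
        finally show ?thesis .
      qed
      then have "?V \<subseteq> {..16 * n ^ 6}" by blast
      then have "finite ?V" using finite_subset by blast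
      then have "max_weight n d \<omega>s \<le> 16 * n ^ 6"
        unfolding max_weight_def using V by (subst Max_le_iff) auto
      then have "real (max_weight n d \<omega>s) \<le> real (16 * n ^ 6)" by (rule of_nat_mono)
      then show ?thesis by simp
    qed
    ultimately show ?thesis by blast
  qed
  show ?thesis
    by (rule exI[of _ 3], rule exI[of _ 16]) (use main in simp)
qed

end
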